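(* Let $g\in \mathcal{S}(\mathbb{R})$ (Schwartz class) with $\|g\|_2=1$. Let $a,b\in\mathbb{R}$ with $b\ne 0$ and let $\Lambda = \{(0,0),(0,1),(0,-1),(a,b),(a,-b)\}$. Then $\{g,\ M_1 g,\ M_{-1}g,\ M_bT_a g,\ M_{-b}T_a g\}$ is linearly independent in $L^2(\mathbb{R})$ whenever any of the following holds: (i) $a,b\in\mathbb{Q}$; (ii) $a\in\mathbb{Q}$ and $b\notin\mathbb{Q}$; (iii) $a\notin\mathbb{Q}$, $b\notin\mathbb{Q}$ and $ab\notin\mathbb{Q}$; (iv) $a,b\notin\mathbb{Q}$, $ab\in\mathbb{Q}$, and $g$ is real-valued.
   Context: $M_b f(x) = e^{2\pi i b x} f(x)$ and $T_a f(x) = f(x-a)$. $\mathcal{S}(\mathbb{R})$ is the Schwartz space of smooth rapidly decreasing functions.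
   Formalization: The five points of Λ are assumed distinct, which excludes exactly a = 0 with b = 1 or b = -1; there M_bT_a g and M_{-b}T_a g coincide with M_1 g and M_{-1} g, so the five listed functions are trivially dependent. *)

theory Defs
  imports "HOL-Analysis.Analysis"
begin

definition modul :: "real \<Rightarrow> (real \<Rightarrow> complex) \<Rightarrow> real \<Rightarrow> complex" ("M") where
  "modul b f = (\<lambda>x. exp (2 * of_real pi * \<i> * of_real b * of_real x) * f x)"

definition transl :: "real \<Rightarrow> (real \<Rightarrow> complex) \<Rightarrow> real \<Rightarrow> complex" ("T") where
  "transl a f = (\<lambda>x. f (x - a))"

definition schwartz :: "(real \<Rightarrow> complex) \<Rightarrow> bool" where
  "schwartz g \<longleftrightarrow> (\<exists>D :: nat \<Rightarrow> real \<Rightarrow> complex.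
      D 0 = g \<and>
      (\<forall>n x. (D n has_vector_derivative D (Suc n) x) (at x)) \<and>
      (\<forall>m n. \<exists>C. \<forall>x. \<bar>x\<bar> ^ m * norm (D n x) \<le> C))"

definition L2_norm :: "(real \<Rightarrow> complex) \<Rightarrow> real" where
  "L2_norm f = sqrt (LINT x|lborel. (cmod (f x))\<^sup>2)"

definition lin_indep_L2 :: "(real \<Rightarrow> complex) list \<Rightarrow> bool" where
  "lin_indep_L2 fs \<longleftrightarrow> (\<forall>c :: nat \<Rightarrow> complex.
      (AE x in lborel. (\<Sum>i<length fs. c i * (fs ! i) x) = 0) \<longrightarrow> (\<forall>i<length fs. c i = 0))"

end

theory Submission
  imports Defs "HOL-Real_Asymp.Real_Asymp"
begin

text \<open>
  A linear relation reads \<open>P x * g x = Q x * g (x - a)\<close> everywhere, where \<open>P\<close> has period 1 and \<open>Q\<close>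
  is a two-term exponential sum, so that \<open>\<bar>Q\<bar>\<close> has period \<open>1 / (2 * b)\<close>. Iterate it \<open>m\<close> times from \<open>x\<close>
  to \<open>x + m * a\<close>, and again from \<open>x - l\<close> to \<open>x + m * a - l\<close> with an integer \<open>l\<close> close to \<open>m * a\<close>. The
  factors \<open>P\<close> cancel, and \<open>g (x + m * a) * g (x - l)\<close> equals \<open>g x * g (x + m * a - l)\<close> times the
  product of the quotients \<open>Q (x + i * a) / Q (x + i * a - l)\<close>. By the pigeonhole principle there are
  arbitrarily large \<open>m\<close> for which also \<open>2 * b * l\<close> is within \<open>O(1 / m)\<close> of an integer, so each
  numerator and denominator differ by \<open>O(1 / m)\<close>. As \<open>Q\<close> has at most simple zeros, averaging
  logarithms over a short interval of \<open>x\<close> shows that for some \<open>x\<close> near a given point the product is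
  not smaller than a fixed negative power of \<open>m\<close>. The rapid decay of \<open>g\<close> then forces \<open>g = 0\<close>.
\<close>


section \<open>Exponentials and trigonometric polynomials\<close>

text \<open>Induction on the frequencies: dividing by the exponential of a new frequency
  \<open>\<mu>\<close> makes its term constant, and differentiating removes it. What remains is a
  relation over \<open>S\<close> whose coefficients carry the nonzero factors
  \<open>\<nu> - \<mu>\<close>.\<close>

lemma exponentials_independent:
  fixes c :: "real \<Rightarrow> complex"
  assumes "finite S" "u < v"
    and "\<And>x. u < x \<Longrightarrow> x < v \<Longrightarrow> (\<Sum>\<kappa>\<in>S. c \<kappa> * cis (\<kappa> * x)) = 0"
    and "\<kappa> \<in> S"
  shows "c \<kappa> = 0"
  using assms(1,3,4)
proof (induction S arbitrary: c \<kappa> rule: finite_induct)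
  case empty
  then show ?case by simp
next
  case (insert \<mu> S)
  have twist: "(\<Sum>\<nu>\<in>S. c \<nu> * cis ((\<nu> - \<mu>) * x)) = - c \<mu>" if "u < x" "x < v" for x
  proof -
    have "(\<Sum>\<nu>\<in>S. c \<nu> * cis ((\<nu> - \<mu>) * x)) = cis (- \<mu> * x) * (\<Sum>\<nu>\<in>S. c \<nu> * cis (\<nu> * x))"
      unfolding sum_distrib_left
      by (intro sum.cong refl) (simp add: cis_mult algebra_simps mult.left_commute[of "cis _"])
    also have "(\<Sum>\<nu>\<in>S. c \<nu> * cis (\<nu> * x)) = - (c \<mu> * cis (\<mu> * x))"
      using insert.prems(1)[OF that] insert.hyps by (simp add: add_eq_0_iff)
    also have "cis (- \<mu> * x) * - (c \<mu> * cis (\<mu> * x)) = - c \<mu>"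
      by (simp add: cis_mult mult.left_commute[of "cis _"])
    finally show ?thesis .
  qed
  have deriv: "(\<Sum>\<nu>\<in>S. (c \<nu> * (\<nu> - \<mu>)) * cis (\<nu> * x)) = 0" if "u < x" "x < v" for x
  proof -
    have d: "((\<lambda>x. \<Sum>\<nu>\<in>S. c \<nu> * cis ((\<nu> - \<mu>) * x)) has_vector_derivative
        (\<Sum>\<nu>\<in>S. c \<nu> * ((\<nu> - \<mu>) *\<^sub>R (\<i> * cis ((\<nu> - \<mu>) * x))))) (at x)"
    proof (intro has_vector_derivative_sum has_vector_derivative_mult_right)
      fix \<nu>
      show "((\<lambda>x. cis ((\<nu> - \<mu>) * x)) has_vector_derivative
          (\<nu> - \<mu>) *\<^sub>R (\<i> * cis ((\<nu> - \<mu>) * x))) (at x)"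
        unfolding has_vector_derivative_def
        by (auto intro!: derivative_eq_intros simp: mult.commute)
    qed
    have "((\<lambda>x. \<Sum>\<nu>\<in>S. c \<nu> * cis ((\<nu> - \<mu>) * x)) has_vector_derivative 0) (at x)"
      by (rule has_vector_derivative_transform_within_open[where S = "{u<..<v}" and f = "\<lambda>_. - c \<mu>"])
        (use twist that in auto)
    from vector_derivative_unique_at[OF d this]
    \<comment> \<open>The factor \<open>- \<i>\<close> cancels the one from the derivative, and
      \<open>cis (\<mu> * x)\<close> undoes the division.\<close>
    have "0 = - \<i> * cis (\<mu> * x) * (\<Sum>\<nu>\<in>S. c \<nu> * ((\<nu> - \<mu>) *\<^sub>R (\<i> * cis ((\<nu> - \<mu>) * x))))"
      by simp
    also have "\<dots> = (\<Sum>\<nu>\<in>S. (c \<nu> * (\<nu> - \<mu>)) * cis (\<nu> * x))"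
      unfolding sum_distrib_left
    proof (intro sum.cong refl)
      fix \<nu> 
      have "cis (\<mu> * x) * cis ((\<nu> - \<mu>) * x) = cis (\<nu> * x)"
        by (simp add: cis_mult algebra_simps)
      then show "- \<i> * cis (\<mu> * x) * (c \<nu> * ((\<nu> - \<mu>) *\<^sub>R (\<i> * cis ((\<nu> - \<mu>) * x)))) =
          c \<nu> * (\<nu> - \<mu>) * cis (\<nu> * x)"
        by (simp add: scaleR_conv_of_real mult_ac flip: \<open>_ = cis (\<nu> * x)\<close>)
    qed
    finally show ?thesis by simp
  qed
  have "c \<nu> = 0" if "\<nu> \<in> S" for \<nu>
    using insert.IH[of "\<lambda>\<nu>. c \<nu> * (\<nu> - \<mu>)", OF deriv that] insert.hyps that by auto
  moreover from this have "c \<mu> = 0"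
    using twist[of "(u + v) / 2"] \<open>u < v\<close> by simp
  ultimately show ?case using insert.prems(2) by auto
qed

text \<open>After multiplication by \<open>cis (2 * pi * x)\<close> this is a nonzero polynomial of
  degree at most 2 in that number. It has finitely many roots, and each is attained on a coset of
  the integers or nowhere.\<close>

lemma countable_trig_poly_zeros:
  fixes p q r :: complex
  assumes "p \<noteq> 0 \<or> q \<noteq> 0 \<or> r \<noteq> 0"
  shows "countable {x. p + q * cis (2 * pi * x) + r * cis (- (2 * pi * x)) = 0}"
proof -
  let ?R = "{z. poly [:r, p, q:] z = 0}"
  have "finite ?R" using assms by (intro poly_roots_finite) auto
  moreover have "countable {x. cis (2 * pi * x) = z}" for z
  proof (cases "\<exists>x0. cis (2 * pi * x0) = z")
    case True
    then obtain x0 where x0: "cis (2 * pi * x0) = z" ..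
    have "{x. cis (2 * pi * x) = z} \<subseteq> range (\<lambda>n::int. x0 + n)"
    proof
      fix x assume "x \<in> {x. cis (2 * pi * x) = z}"
      then have "cis (2 * pi * (x - x0)) = 1"
        using x0 cis_neq_zero[of "2 * pi * x0"] by (simp add: right_diff_distrib del: cis_neq_zero flip: cis_divide)
      then obtain n :: int where "2 * pi * (x - x0) = 2 * pi * n"
        by (auto simp: cis_conv_exp exp_eq_1)
      then have "x = x0 + n" by simp
      then show "x \<in> range (\<lambda>n::int. x0 + n)" by auto
    qed
    then show ?thesis by (rule countable_subset) simp
  qed auto
  ultimately have "countable (\<Union>z\<in>?R. {x. cis (2 * pi * x) = z})"
    by (intro countable_UN) (auto intro: countable_finite)
  moreover have "x \<in> (\<Union>z\<in>?R. {x. cis (2 * pi * x) = z})"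
    if "p + q * cis (2 * pi * x) + r * cis (- (2 * pi * x)) = 0" for x
  proof -
    have "poly [:r, p, q:] (cis (2 * pi * x)) =
        cis (2 * pi * x) * (p + q * cis (2 * pi * x) + r * cis (- (2 * pi * x)))"
      by (simp add: algebra_simps cis_mult)
    then show ?thesis using that by simp
  qed
  ultimately show ?thesis by (elim countable_subset[rotated]) blast
qed

section \<open>Logarithmic singularities and zeros of two-term sums\<close>

text \<open>For \<open>s > 0\<close> the integrand \<open>ln (1 + \<eta> / s)\<close> has the
  explicit antiderivative \<open>H\<close>. With \<open>\<eta>\<close> of order
  \<open>1 / m\<close>, the bound lets \<open>m\<close> such integrals add up to only
  \<open>O(ln m)\<close>.\<close>

lemma integral_ln_singularity:
  fixes \<eta> A z u v :: real
  assumes "\<eta> > 0" "A > 0" and near: "\<And>y. u \<le> y \<Longrightarrow> y \<le> v \<Longrightarrow> \<bar>y - z\<bar> \<le> A"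
  shows "(\<lambda>y. ln (1 + \<eta> / \<bar>y - z\<bar>)) integrable_on {u..v}"
    and "integral {u..v} (\<lambda>y. ln (1 + \<eta> / \<bar>y - z\<bar>)) \<le> 2 * \<eta> * (1 + ln (1 + A / \<eta>))"
proof -
  let ?f = "\<lambda>s. ln (1 + \<eta> / \<bar>s\<bar>)"
  define H where "H s = (s + \<eta>) * ln (s + \<eta>) - s * ln s" for s
  define B where "B = H A - H 0"
  have pos: "(?f has_integral B) {0..A}"
    unfolding B_def
  proof (rule fundamental_theorem_of_calculus_interior)
    show "continuous_on {0..A} H"
    proof -
      have "((\<lambda>s::real. s * ln s) \<longlongrightarrow> 0 * ln 0) (at_right 0)"
        by simp real_asymp
      then have "((\<lambda>s. s * ln s) \<longlongrightarrow> 0 * ln 0) (at 0 within {0..A})"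
        using at_within_Icc_at_right[of 0 A] assms by simp
      moreover have "isCont (\<lambda>s. s * ln s) s" if "s > 0" for s :: real
        using that by (intro continuous_intros) auto
      ultimately have "continuous_on {0..A} (\<lambda>s. s * ln s)"
        unfolding continuous_on_eq_continuous_within
        by (metis atLeastAtMost_iff continuous_at_imp_continuous_at_within continuous_within less_eq_real_def)
      then show ?thesis unfolding H_def using assms(1)
        by (intro continuous_on_diff[OF _ \<open>continuous_on {0..A} _\<close>] continuous_intros) auto
    qed
    show "(H has_vector_derivative ?f s) (at s)" if "s \<in> {0<..<A}" for s
    proof -
      have "1 + \<eta> / s = (s + \<eta>) / s" using that by (simp add: field_simps)
      then have "ln (s + \<eta>) - ln s = ?f s" using that assms by (simp add: ln_div)
      then show ?thesis unfolding H_def using that assms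
        by (auto intro!: derivative_eq_intros simp flip: has_real_derivative_iff_has_vector_derivative)
    qed
  qed (use assms in simp)
  have "(?f has_integral B) {-A..0}"
    using has_integral_reflect_real[of ?f B A 0] pos by simp
  from has_integral_combine[OF _ _ this pos]
  have int: "(?f has_integral 2 * B) {-A..A}" using assms by simp
  have shift: "((\<lambda>y. ?f (y - z)) has_integral 2 * B) {z-A..z+A}"
    using has_integral_affinity'[OF int[folded cbox_interval], of 1 "-z"] by (simp add: add.commute)
  have sub: "{u..v} \<subseteq> {z-A..z+A}" using near by (fastforce simp: abs_le_iff)
  show i: "(\<lambda>y. ?f (y - z)) integrable_on {u..v}"
    using integrable_on_subinterval[OF _ sub] shift by blast
  have "integral {u..v} (\<lambda>y. ?f (y - z)) \<le> 2 * B"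
    using integral_subset_le[OF sub i] shift assms by (auto simp: has_integral_iff)
  also have "B = A * ln (1 + \<eta> / A) + \<eta> * ln (1 + A / \<eta>)"
  proof -
    have "1 + \<eta> / A = (A + \<eta>) / A" "1 + A / \<eta> = (A + \<eta>) / \<eta>"
      using assms(1,2) by (simp_all add: field_simps)
    then have "ln (1 + \<eta> / A) = ln (A + \<eta>) - ln A" "ln (1 + A / \<eta>) = ln (A + \<eta>) - ln \<eta>"
      using assms(1,2) by (simp_all add: ln_div)
    then show ?thesis by (simp add: B_def H_def right_diff_distrib distrib_right)
  qed
  also have "A * ln (1 + \<eta> / A) \<le> A * (\<eta> / A)"
    using assms by (intro mult_left_mono ln_add_one_self_le_self) auto
  finally show "integral {u..v} (\<lambda>y. ?f (y - z)) \<le> 2 * \<eta> * (1 + ln (1 + A / \<eta>))"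
    using assms by (simp add: algebra_simps)
qed

text \<open>The Taylor remainder is at most \<open>\<bar>s\<bar> ^ 3 / 6\<close>, hence at most two
  thirds of \<open>\<bar>s\<bar>\<close>. The range goes beyond \<open>pi / 2\<close> to leave room
  for an interval of positive length in the next lemma.\<close>

lemma sin_abs_ge:
  fixes s :: real
  assumes "\<bar>s\<bar> \<le> 2"
  shows "\<bar>s\<bar> / 3 \<le> \<bar>sin s\<bar>"
proof -
  have "\<bar>sin s - s\<bar> \<le> \<bar>s\<bar> ^ 3 / 6"
    using Maclaurin_sin_bound[of s 3]
    by (simp add: sin_coeff_def numeral_3_eq_3 fact_numeral divide_simps)
  also have "\<bar>s\<bar> ^ 3 \<le> \<bar>s\<bar> * 2\<^sup>2"
    unfolding power3_eq_cube mult.assoc power2_eq_square using assms by (intro mult_left_mono mult_mono) auto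
  finally show ?thesis by (simp add: abs_if split: if_splits)
qed

text \<open>The sum has at most simple zeros, so on short intervals it is bounded below by a
  multiple of the distance to one point. The constants serve all \<open>u\<close> at once, which
  matters because the lemma is applied along a whole orbit.\<close>

lemma two_term_lower_bound:
  fixes p q :: complex and b :: real
  assumes "p \<noteq> 0 \<or> q \<noteq> 0" "b \<noteq> 0"
  obtains c A L where "c > 0" "A > 0" "L > 0"
    "\<And>u. \<exists>z. \<forall>y\<in>{u..u + L}. \<bar>y - z\<bar> \<le> A \<and> c * \<bar>y - z\<bar> \<le> cmod (p * cis (2 * pi * b * y) + q * cis (- (2 * pi * b * y)))"
proof (cases "cmod p = cmod q")
  case False
  \<comment> \<open>With different moduli there is no zero, and \<open>u\<close> is an arbitrary
    choice of \<open>z\<close>.\<close>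
  have "\<bar>cmod p - cmod q\<bar> * \<bar>y - u\<bar> \<le> cmod (p * cis (2 * pi * b * y) + q * cis (- (2 * pi * b * y)))"
    if "y \<in> {u..u + 1}" for y u
  proof -
    have "\<bar>cmod p - cmod q\<bar> * \<bar>y - u\<bar> \<le> \<bar>cmod p - cmod q\<bar>"
      using that by (intro mult_right_le_one_le) auto
    also have "\<dots> \<le> cmod (p * cis (2 * pi * b * y) - - (q * cis (- (2 * pi * b * y))))"
      using norm_triangle_ineq3[of "p * cis (2 * pi * b * y)" "- (q * cis (- (2 * pi * b * y)))"]
      by (simp add: norm_mult)
    finally show ?thesis by simp
  qed
  then have "\<exists>z. \<forall>y\<in>{u..u + 1}. \<bar>y - z\<bar> \<le> 1 \<and> \<bar>cmod p - cmod q\<bar> * \<bar>y - z\<bar> \<le>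
      cmod (p * cis (2 * pi * b * y) + q * cis (- (2 * pi * b * y)))" for u
    by (intro exI[of _ u]) auto
  then show ?thesis
    using False by (intro that[of "\<bar>cmod p - cmod q\<bar>" 1 1]) auto
next
  case True
  define \<omega> where "\<omega> = 2 * pi * b"
  \<comment> \<open>Factoring out the mean phase \<open>(Arg p + Arg q) / 2\<close> leaves a real
    cosine with phase shift \<open>\<phi>\<close>.\<close>
  define \<phi> where "\<phi> = (Arg p - Arg q) / 2"
  have r: "cmod p > 0" using assms True by auto
  have \<omega>: "\<omega> \<noteq> 0" using assms by (simp add: \<omega>_def)
  have Q: "cmod (p * cis (\<omega> * y) + q * cis (- (\<omega> * y))) = 2 * cmod p * \<bar>cos (\<omega> * y + \<phi>)\<bar>" for y
  proof -
    have "p = cmod p * cis (Arg p)" "q = cmod p * cis (Arg q)"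
      using rcis_cmod_Arg[of p] rcis_cmod_Arg[of q] True by (simp_all add: rcis_def)
    then have "p * cis (\<omega> * y) + q * cis (- (\<omega> * y)) =
        cmod p * (cis (Arg p + \<omega> * y) + cis (Arg q - \<omega> * y))"
      by (metis (no_types, lifting) ab_group_add_class.ab_diff_conv_add_uminus cis_mult distrib_left mult.assoc)
    also have "cis (Arg p + \<omega> * y) + cis (Arg q - \<omega> * y) =
        cis ((Arg p + Arg q) / 2) * (cis (\<omega> * y + \<phi>) + cis (- (\<omega> * y + \<phi>)))"
    proof -
      have "(Arg p + Arg q) / 2 + (\<omega> * y + \<phi>) = Arg p + \<omega> * y"
        "(Arg p + Arg q) / 2 + - (\<omega> * y + \<phi>) = Arg q - \<omega> * y"
        by (simp_all add: \<phi>_def field_simps)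
      then show ?thesis unfolding distrib_left cis_mult by (simp only:)
    qed
    also have "cis (\<omega> * y + \<phi>) + cis (- (\<omega> * y + \<phi>)) = complex_of_real (2 * cos (\<omega> * y + \<phi>))"
      unfolding complex_eq_iff by (simp del: minus_add_distrib)
    finally show ?thesis by (simp add: norm_mult)
  qed
  \<comment> \<open>Over a length \<open>L\<close> the argument of the cosine moves by at most 2/5.
    Together with \<open>pi / 2 \<le> 8 / 5\<close> this stays within the range of
    \<open>sin_abs_ge\<close>.\<close>
  define L where "L = 2 / (5 * \<bar>\<omega>\<bar>)"
  show ?thesis
  proof (rule that)
    show "2 * cmod p * (\<bar>\<omega>\<bar> / 3) > 0" "2 / \<bar>\<omega>\<bar> > 0" "L > 0"
      using r \<omega> by (auto simp: L_def)
    fix u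
    \<comment> \<open>The half-period \<open>n\<close> contains the argument at \<open>u\<close>.
      Its midpoint \<open>\<theta>\<close> is a zero of the cosine at distance at most
      \<open>pi / 2\<close>.\<close>
    define n where "n = \<lfloor>(\<omega> * u + \<phi>) / pi\<rfloor>"
    define \<theta> where "\<theta> = pi / 2 + pi * n"
    have n: "pi * n \<le> \<omega> * u + \<phi>" "\<omega> * u + \<phi> \<le> pi * (n + 1)"
      using floor_divide_lower[OF pi_gt_zero, of "\<omega> * u + \<phi>"] floor_divide_upper[OF pi_gt_zero, of "\<omega> * u + \<phi>"]
      by (simp_all add: n_def mult.commute)
    show "\<exists>z. \<forall>y\<in>{u..u + L}. \<bar>y - z\<bar> \<le> 2 / \<bar>\<omega>\<bar> \<and> 2 * cmod p * (\<bar>\<omega>\<bar> / 3) * \<bar>y - z\<bar> \<le>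
        cmod (p * cis (2 * pi * b * y) + q * cis (- (2 * pi * b * y)))"
    proof (intro exI[of _ "(\<theta> - \<phi>) / \<omega>"] ballI)
      fix y assume y: "y \<in> {u..u + L}"
      define s where "s = \<omega> * y + \<phi> - \<theta>"
      have s_eq: "\<bar>s\<bar> = \<bar>\<omega>\<bar> * \<bar>y - (\<theta> - \<phi>) / \<omega>\<bar>"
        unfolding s_def using \<omega> by (simp add: field_simps flip: abs_mult)
      have "\<bar>\<omega> * (y - u)\<bar> \<le> \<bar>\<omega>\<bar> * L"
        unfolding abs_mult using y by (intro mult_left_mono) auto
      also have "\<dots> = 2 / 5" using \<omega> by (simp add: L_def)
      finally have "\<bar>\<omega> * y - \<omega> * u\<bar> \<le> 2 / 5" by (simp add: algebra_simps)
      moreover have "\<bar>\<omega> * u + \<phi> - \<theta>\<bar> \<le> pi / 2"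
        using n unfolding \<theta>_def by (intro abs_leI) (simp_all add: distrib_left)
      moreover have "pi / 2 \<le> 8 / 5" using pi_approx by simp
      ultimately have s2: "\<bar>s\<bar> \<le> 2" unfolding s_def by linarith
      have "cos (\<omega> * y + \<phi>) = cos ((s + pi / 2) + pi * n)" by (simp add: s_def \<theta>_def)
      also have "\<bar>\<dots>\<bar> = \<bar>sin s\<bar>"
        by (simp add: cos_add sin_add abs_mult)
      finally have cs: "\<bar>cos (\<omega> * y + \<phi>)\<bar> = \<bar>sin s\<bar>" .
      have "2 * cmod p * (\<bar>\<omega>\<bar> / 3) * \<bar>y - (\<theta> - \<phi>) / \<omega>\<bar> = 2 * cmod p * (\<bar>s\<bar> / 3)"
        by (simp add: s_eq)
      also have "\<dots> \<le> 2 * cmod p * \<bar>sin s\<bar>"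
        using sin_abs_ge[OF s2] by (intro mult_left_mono) auto
      finally show "\<bar>y - (\<theta> - \<phi>) / \<omega>\<bar> \<le> 2 / \<bar>\<omega>\<bar> \<and> 2 * cmod p * (\<bar>\<omega>\<bar> / 3) * \<bar>y - (\<theta> - \<phi>) / \<omega>\<bar> \<le>
          cmod (p * cis (2 * pi * b * y) + q * cis (- (2 * pi * b * y)))"
        using s2 s_eq \<omega> Q[of y] cs by (simp add: \<omega>_def field_simps)
    qed
  qed
qed

section \<open>Simultaneous approximation with large return times\<close>

text \<open>For \<open>m * a\<close> a fixed accuracy is enough, but \<open>\<beta> * l\<close>
  needs accuracy \<open>C / m\<close> because \<open>m\<close> errors will be compounded. If a
  nonzero multiple of \<open>\<beta>\<close> is an integer, one-dimensional approximation suffices;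
  otherwise a two-dimensional pigeonhole argument is used.\<close>

lemma good_return_times:
  fixes a \<beta> \<epsilon> :: real
  assumes "a \<noteq> 0" "\<epsilon> > 0"
  obtains C :: real where "C > 0"
    "\<And>N::nat. \<exists>m::nat. \<exists>(l::int) (k::int). N \<le> m \<and> 0 < m \<and> \<bar>m * a - l\<bar> < \<epsilon> \<and> \<bar>\<beta> * l - k\<bar> \<le> C / m"
proof (cases "\<exists>s::int. s \<noteq> 0 \<and> \<beta> * s \<in> \<int>")
  case True
  then obtain s r :: int where s: "s \<noteq> 0" "\<beta> * s = r" by (auto elim: Ints_cases)
  have "\<exists>m::nat. \<exists>(l::int) (k::int). N \<le> m \<and> 0 < m \<and> \<bar>m * a - l\<bar> < \<epsilon> \<and> \<bar>\<beta> * l - k\<bar> \<le> 1 / m" for N :: nat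
  proof -
    obtain K :: nat where K: "K > 0" "1 / K < \<epsilon> / \<bar>s\<bar>"
      using reals_Archimedean[of "\<epsilon> / \<bar>s\<bar>"] assms s by (auto simp: inverse_eq_divide intro!: that[of "Suc _"])
    \<comment> \<open>The witnesses are \<open>m = q * Suc N\<close>, \<open>l = s * h\<close> and
      \<open>k = r * h\<close>. The factor \<open>Suc N\<close> makes \<open>m\<close> large, and
      \<open>\<beta> * l\<close> equals \<open>k\<close> exactly.\<close>
    obtain h q where hq: "0 < q" "\<bar>of_int q * (Suc N * a / s) - of_int h\<bar> < 1 / K"
      using Dirichlet_approx[OF K(1), of "Suc N * a / s"] by blast
    have "of_int q * (Suc N * a / s) - of_int h = (of_int q * Suc N * a - s * h) / s"
      using s by (simp add: field_simps)
    then have "\<bar>of_int q * Suc N * a - s * h\<bar> < \<epsilon>"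
      using order.strict_trans[OF hq(2) K(2)] s(1) by (simp add: abs_divide divide_less_cancel)
    moreover have "int N \<le> q * Suc N" using mult_right_mono[of 1 q "int (Suc N)"] hq(1) by (smt (verit) int_one_le_iff_zero_less of_nat_0_le_iff of_nat_Suc)
    moreover have "\<bar>\<beta> * real_of_int (s * h) - real_of_int (r * h)\<bar> \<le> 1 / nat (q * Suc N)"
      using s(2) by (simp flip: mult.assoc)
    ultimately have "N \<le> nat (q * Suc N) \<and> 0 < nat (q * Suc N) \<and>
        \<bar>nat (q * Suc N) * a - real_of_int (s * h)\<bar> < \<epsilon> \<and>
        \<bar>\<beta> * real_of_int (s * h) - real_of_int (r * h)\<bar> \<le> 1 / nat (q * Suc N)"
      using hq(1) by (intro conjI) (simp_all add: le_nat_iff)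
    then show ?thesis by - (rule exI, rule exI, rule exI, assumption)
  qed
  then show ?thesis by (intro that[of 1]) auto
next
  case irr: False
  \<comment> \<open>The bound by \<open>\<bar>a\<bar>\<close> will exclude
    \<open>l = 0\<close>.\<close>
  obtain K :: nat where K: "K > 0" "1 / K < min \<epsilon> \<bar>a\<bar>"
    using reals_Archimedean[of "min \<epsilon> \<bar>a\<bar>"] assms by (auto simp: inverse_eq_divide intro!: that[of "Suc _"])
  have box: "nat \<lfloor>frac x * J\<rfloor> < J" if "J > 0" for x :: real and J :: nat
    using frac_ge_0[of x] frac_lt_1[of x] that by (simp add: nat_less_iff floor_less_iff)
  have close: "\<bar>frac x - frac y\<bar> < 1 / J" if "nat \<lfloor>frac x * J\<rfloor> = nat \<lfloor>frac y * J\<rfloor>" "J > 0"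
    for x y :: real and J :: nat
  proof -
    have "\<lfloor>frac x * J\<rfloor> = \<lfloor>frac y * J\<rfloor>" using that by (simp add: nat_eq_iff2)
    then have "\<bar>frac x * J - frac y * J\<bar> < 1" by linarith
    then have "\<bar>frac x - frac y\<bar> * J < 1"
      by (simp add: abs_mult flip: left_diff_distrib)
    then show ?thesis using that by (simp add: pos_less_divide_eq)
  qed
  \<comment> \<open>Sort the pairs of fractional parts of \<open>j * a\<close> and \<open>\<beta> * \<lfloor>j * a\<rfloor>\<close>, for \<open>j \<le> K * J\<close>, into a \<open>K\<close> by \<open>J\<close> grid.\<close>
  have step: "\<exists>m::nat. \<exists>(l::int) (k::int). 0 < m \<and> m \<le> K * J \<and> \<bar>m * a - l\<bar> < 1 / K \<and> \<bar>\<beta> * l - k\<bar> < 1 / J"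
    if J: "J > 0" for J :: nat
  proof -
    define f where "f j = (nat \<lfloor>frac (real j * a) * K\<rfloor>, nat \<lfloor>frac (\<beta> * \<lfloor>real j * a\<rfloor>) * J\<rfloor>)" for j :: nat
    have "f ` {..K * J} \<subseteq> {..<K} \<times> {..<J}" using box J K by (auto simp: f_def)
    then have "card (f ` {..K * J}) \<le> K * J"
      using card_mono[of "{..<K} \<times> {..<J}"] by (simp add: card_cartesian_product)
    then have "\<not> inj_on f {..K * J}" using card_image by fastforce
    then obtain i j where ij: "i < j" "j \<le> K * J" "f i = f j"
      unfolding inj_on_def by (metis atMost_iff linorder_neqE_nat)
    let ?l = "\<lfloor>real j * a\<rfloor> - \<lfloor>real i * a\<rfloor>"
    let ?k = "\<lfloor>\<beta> * \<lfloor>real j * a\<rfloor>\<rfloor> - \<lfloor>\<beta> * \<lfloor>real i * a\<rfloor>\<rfloor>"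
    have "real (j - i) * a - ?l = frac (real j * a) - frac (real i * a)"
      using ij by (simp add: frac_def of_nat_diff algebra_simps)
    moreover have "\<bar>frac (real j * a) - frac (real i * a)\<bar> < 1 / K"
      using ij K by (intro close) (auto simp: f_def)
    moreover have "\<beta> * ?l - ?k = frac (\<beta> * \<lfloor>real j * a\<rfloor>) - frac (\<beta> * \<lfloor>real i * a\<rfloor>)"
      by (simp add: frac_def algebra_simps)
    moreover have "\<bar>frac (\<beta> * \<lfloor>real j * a\<rfloor>) - frac (\<beta> * \<lfloor>real i * a\<rfloor>)\<bar> < 1 / J"
      using ij J by (intro close) (auto simp: f_def)
    ultimately have "0 < j - i \<and> j - i \<le> K * J \<and> \<bar>real (j - i) * a - ?l\<bar> < 1 / K \<and> \<bar>\<beta> * ?l - ?k\<bar> < 1 / J"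
      using ij by auto
    then show ?thesis by blast
  qed
  have "\<exists>m::nat. \<exists>(l::int) (k::int). N \<le> m \<and> 0 < m \<and> \<bar>m * a - l\<bar> < \<epsilon> \<and> \<bar>\<beta> * l - k\<bar> \<le> real K / m" for N :: nat
  proof -
    \<comment> \<open>\<open>S\<close> contains every nonzero \<open>l\<close> that could arise from
      some \<open>m < N\<close>. On it \<open>\<beta> * l\<close> keeps a positive distance from the
      integers, so a grid with \<open>1 / J < \<mu>\<close> forces \<open>N \<le> m\<close>.\<close>
    define S where "S = {- \<lceil>N * \<bar>a\<bar> + 1\<rceil>..\<lceil>N * \<bar>a\<bar> + 1\<rceil>} - {0::int}"
    define \<mu> where "\<mu> = Min (insert 1 ((\<lambda>l. \<bar>\<beta> * l - round (\<beta> * l)\<bar>) ` S))"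
    have "\<bar>\<beta> * l - round (\<beta> * l)\<bar> > 0" if "l \<in> S" for l
    proof -
      have "\<beta> * l \<notin> \<int>" using irr that by (auto simp: S_def)
      then have "\<beta> * l \<noteq> round (\<beta> * l)" by (metis Ints_of_int)
      then show ?thesis by simp
    qed
    then have "\<mu> > 0" unfolding \<mu>_def by (subst Min_gr_iff) (auto simp: S_def)
    then obtain J :: nat where J: "J > 0" "1 / J < \<mu>"
      using reals_Archimedean[of \<mu>] by (auto simp: inverse_eq_divide intro!: that[of "Suc _"])
    from step[OF J(1)] obtain m :: nat and l k :: int where
      m: "0 < m" "m \<le> K * J" and l: "\<bar>m * a - l\<bar> < 1 / K" and k: "\<bar>\<beta> * l - k\<bar> < 1 / J" by blast
    have "N \<le> m"
    proof (rule ccontr)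
      assume "\<not> N \<le> m"
      then have "m * \<bar>a\<bar> \<le> N * \<bar>a\<bar>" by (intro mult_right_mono) auto
      moreover have "1 / K \<le> 1" using K by simp
      moreover have "\<bar>m * a\<bar> = m * \<bar>a\<bar>" by (simp add: abs_mult)
      ultimately have "\<bar>real_of_int l\<bar> \<le> N * \<bar>a\<bar> + 1" using l by linarith
      moreover have "l \<noteq> 0"
      proof
        assume "l = 0"
        then have "m * \<bar>a\<bar> < \<bar>a\<bar>" using l K by (simp add: abs_mult)
        then show False using m mult_right_mono[of 1 "real m" "\<bar>a\<bar>"] by simp
      qed
      ultimately have "l \<in> S" unfolding S_def by (auto simp: abs_le_iff le_ceiling_iff) linarith+
      then have "\<mu> \<le> \<bar>\<beta> * l - round (\<beta> * l)\<bar>" unfolding \<mu>_def by (intro Min_le) (auto simp: S_def)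
      also have "\<dots> \<le> \<bar>\<beta> * l - k\<bar>"
        using round_diff_minimal[of "\<beta> * l" k] by simp
      finally show False using k J by simp
    qed
    \<comment> \<open>The pigeonhole bound \<open>m \<le> K * J\<close> turns the grid width into an
      error of order \<open>1 / m\<close>.\<close>
    moreover have "1 / J \<le> K / m" using m J by (simp add: field_simps flip: of_nat_mult)
    ultimately have "\<bar>\<beta> * l - k\<bar> \<le> K / m" using k by linarith
    moreover have "\<bar>m * a - l\<bar> < \<epsilon>" using l K by linarith
    ultimately show ?thesis using \<open>N \<le> m\<close> m(1) by blast
  qed
  then show ?thesis using K by (intro that[of "real K"]) auto
qed

section \<open>Averaging and iteration of the relation\<close>

text \<open>A countable set is negligible, so the point below the average can also avoid it. Here
  this set will hold the zeros of \<open>P\<close> and the singularities of the logarithms.\<close>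

lemma ex_point_le_average:
  fixes F :: "real \<Rightarrow> real"
  assumes "u < v" "F integrable_on {u..v}" "integral {u..v} F < B * (v - u)" "countable N"
  shows "\<exists>x. u \<le> x \<and> x \<le> v \<and> x \<notin> N \<and> F x \<le> B"
proof (rule ccontr)
  assume "\<not> ?thesis"
  then have gt: "B < F x" if "x \<in> {u..v} - N" for x
    using that by force
  have "negligible N" using countable_imp_null_set_lborel[OF assms(4)]
    by (simp add: negligible_iff_null_sets null_sets_completionI)
  then have "((\<lambda>x. if x \<in> N then B else F x) has_integral integral {u..v} F) {u..v}"
    by (rule has_integral_spike[OF _ _ integrable_integral[OF assms(2)]]) auto
  moreover have "((\<lambda>x. B) has_integral B * (v - u)) {u..v}"
    using has_integral_const_real[of B u v] assms(1) by (simp add: mult.commute)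
  ultimately have "B * (v - u) \<le> integral {u..v} F"
    using gt by (elim has_integral_le[rotated]) (auto intro: less_imp_le)
  then show False using assms(3) by simp
qed

lemma transfer_iterate:
  fixes g P Q :: "real \<Rightarrow> complex"
  assumes "\<And>x. P x * g x = Q x * g (x - a)"
  shows "(\<Prod>i=1..m. P (x + real i * a)) * g (x + real m * a) = (\<Prod>i=1..m. Q (x + real i * a)) * g x"
proof (induction m)
  case (Suc m)
  let ?y = "x + real (Suc m) * a"
  have "(\<Prod>i=1..Suc m. P (x + real i * a)) * g ?y = (\<Prod>i=1..m. P (x + real i * a)) * (P ?y * g ?y)"
    by (simp add: mult_ac)
  also have "P ?y * g ?y = Q ?y * g (x + real m * a)"
    using assms[of ?y] by (simp add: algebra_simps)
  also have "(\<Prod>i=1..m. P (x + real i * a)) * (Q ?y * g (x + real m * a)) =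
      Q ?y * ((\<Prod>i=1..m. Q (x + real i * a)) * g x)"
    unfolding Suc.IH[symmetric] by (simp add: mult_ac)
  also have "\<dots> = (\<Prod>i=1..Suc m. Q (x + real i * a)) * g x"
    by (simp add: mult_ac)
  finally show ?case .
qed simp

text \<open>Both iterations, from \<open>x\<close> and from \<open>x - l\<close>, carry the same
  product of values of \<open>P\<close>, which cancels. The cross-multiplied form needs no division
  by values of \<open>Q\<close>.\<close>

lemma transfer_exchange:
  fixes g P Q :: "real \<Rightarrow> complex" and x :: real and l :: int
  assumes eq: "\<And>x. P x * g x = Q x * g (x - a)"
    and per: "\<And>x::real. P (x - l) = P x"
    and nz: "\<And>i. i \<in> {1..m} \<Longrightarrow> P (x + real i * a) \<noteq> 0"
  shows "g (x + real m * a) * g (x - l) * (\<Prod>i=1..m. Q (x + real i * a - l)) =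
    g x * g (x + real m * a - l) * (\<Prod>i=1..m. Q (x + real i * a))"
proof -
  let ?p = "\<Prod>i=1..m. P (x + real i * a)"
  note iterate = transfer_iterate[where P = P and Q = Q and g = g and a = a, OF eq]
  have "(\<Prod>i=1..m. P (x - l + real i * a)) = ?p"
    using per[of "x + real i * a" for i] by (simp add: algebra_simps)
  with iterate[where m = m and x = "x - l"]
  have "?p * g (x + real m * a - l) = (\<Prod>i=1..m. Q (x + real i * a - l)) * g (x - l)"
    by (simp add: algebra_simps)
  moreover have "?p * g (x + real m * a) = (\<Prod>i=1..m. Q (x + real i * a)) * g x"
    by (rule iterate)
  ultimately have "?p * (g (x + real m * a) * g (x - l) * (\<Prod>i=1..m. Q (x + real i * a - l))) =
      ?p * (g x * g (x + real m * a - l) * (\<Prod>i=1..m. Q (x + real i * a)))"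
    by algebra
  moreover have "?p \<noteq> 0" using nz by simp
  ultimately show ?thesis by simp
qed

lemma cmod_cis_minus_one_le: "cmod (cis t - 1) \<le> \<bar>t\<bar>"
  using dist_exp_i_1[of t] abs_sin_x_le_abs_x[of "t / 2"] by (simp add: cis_conv_exp)

text \<open>Up to a common unimodular factor, the shift by \<open>l\<close> only changes the
  relative phase of the two terms, by \<open>4 * pi * b * l\<close>. Hence the frequency that must
  return is \<open>2 * b\<close>.\<close>

lemma two_term_almost_periodic:
  fixes p q :: complex and b y :: real and l k :: int
  defines "Q \<equiv> \<lambda>y. p * cis (2 * pi * b * y) + q * cis (- (2 * pi * b * y))"
  shows "cmod (Q (y - l)) \<le> cmod (Q y) + 2 * pi * cmod p * \<bar>2 * b * l - k\<bar>"
proof -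
  let ?w = "cis (- (2 * pi * (2 * b * l - k)))"
  have "cis (2 * pi * k) = 1" by (simp add: cis_conv_exp exp_eq_1)
  then have w: "?w = cis (- (4 * pi * b * l))"
    using cis_mult[of "- (4 * pi * b * l)" "2 * pi * k"] by (simp add: algebra_simps)
  have "Q (y - l) = cis (2 * pi * b * l) * (Q y + p * cis (2 * pi * b * y) * (?w - 1))"
    unfolding w Q_def by (simp add: algebra_simps cis_mult mult.left_commute[of "cis _"])
  then have "cmod (Q (y - l)) \<le> cmod (Q y) + cmod p * cmod (?w - 1)"
    using norm_triangle_ineq[of "Q y" "p * cis (2 * pi * b * y) * (?w - 1)"] by (simp add: norm_mult)
  also have "cmod p * cmod (?w - 1) \<le> cmod p * (2 * pi * \<bar>2 * b * l - k\<bar>)"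
    using cmod_cis_minus_one_le[of "- (2 * pi * (2 * b * l - k))"]
    by (intro mult_left_mono) (simp_all add: abs_mult)
  finally show ?thesis by (simp add: mult_ac)
qed

section \<open>Rapid decay against polynomial loss\<close>

text \<open>The quotients of \<open>Q\<close> lose at most a factor \<open>W * m ^ \<kappa>\<close>,
  with \<open>\<kappa>\<close> independent of \<open>m\<close>. Decay of order
  \<open>Suc \<kappa>\<close> then beats the loss by one power of \<open>m\<close>.\<close>

lemma no_decaying_solution:
  fixes g :: "real \<Rightarrow> complex" and a b :: real and p\<^sub>0 p\<^sub>1 p\<^sub>2 q\<^sub>1 q\<^sub>2 :: complex
  defines "P \<equiv> \<lambda>x. p\<^sub>0 + p\<^sub>1 * cis (2 * pi * x) + p\<^sub>2 * cis (- (2 * pi * x))"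
  defines "Q \<equiv> \<lambda>x. q\<^sub>1 * cis (2 * pi * b * x) + q\<^sub>2 * cis (- (2 * pi * b * x))"
  assumes ab: "a \<noteq> 0" "b \<noteq> 0"
    and cont: "continuous_on UNIV g"
    and decay: "\<And>n. \<exists>C. \<forall>x. \<bar>x\<bar> ^ n * cmod (g x) \<le> C"
    and eq: "\<And>x. P x * g x = Q x * g (x - a)"
    and P: "p\<^sub>0 \<noteq> 0 \<or> p\<^sub>1 \<noteq> 0 \<or> p\<^sub>2 \<noteq> 0" and Q: "q\<^sub>1 \<noteq> 0 \<or> q\<^sub>2 \<noteq> 0"
  shows "g x\<^sub>0 = 0"
proof (rule ccontr)
  assume "g x\<^sub>0 \<noteq> 0"
  define d where "d = cmod (g x\<^sub>0) / 2"
  have d: "d > 0" using \<open>g x\<^sub>0 \<noteq> 0\<close> by (simp add: d_def)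
  have "isCont g x\<^sub>0" using cont by (simp add: continuous_on_eq_continuous_at)
  then obtain r where r: "r > 0" "\<And>x. \<bar>x - x\<^sub>0\<bar> < r \<Longrightarrow> cmod (g x - g x\<^sub>0) < d"
    using d unfolding continuous_at_eps_delta by (auto simp: dist_norm)
  have large: "d \<le> cmod (g x)" if "\<bar>x - x\<^sub>0\<bar> < r" for x
    using r(2)[OF that] norm_triangle_ineq2[of "g x\<^sub>0" "g x"] by (simp add: d_def norm_minus_commute)
  obtain c A L where cAL: "c > 0" "A > 0" "L > 0"
    "\<And>u. \<exists>z. \<forall>y\<in>{u..u + L}. \<bar>y - z\<bar> \<le> A \<and> c * \<bar>y - z\<bar> \<le> cmod (Q y)"
    unfolding Q_def using two_term_lower_bound[OF Q ab(2)] by metis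
  \<comment> \<open>\<open>x\<close> moves by at most \<open>r / 2\<close> and
    \<open>m * a - l\<close> adds less than \<open>r / 2\<close>, so \<open>x\<close> and
    \<open>x + m * a - l\<close> both stay where \<open>g\<close> is bounded below by
    \<open>d\<close>.\<close>
  define h where "h = min L (r / 2)"
  have h: "h > 0" "h \<le> L" "h \<le> r / 2" using cAL r by (auto simp: h_def)
  have "r / 2 > 0" using r by simp
  from good_return_times[OF ab(1) this, of "2 * b"] obtain C where "C > 0" and return:
    "\<And>N::nat. \<exists>m::nat. \<exists>(l::int) (k::int). N \<le> m \<and> 0 < m \<and> \<bar>m * a - l\<bar> < r / 2 \<and> \<bar>2 * b * l - k\<bar> \<le> C / m"
    by metis
  \<comment> \<open>Chosen so that the perturbation of \<open>Q\<close> is at most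
    \<open>c * D / m\<close>; the summand 1 keeps \<open>D\<close> positive when
    \<open>q\<^sub>1 = 0\<close>.\<close>
  define D where "D = (2 * pi * cmod q\<^sub>1 * C + 1) / c"
  have D: "D > 0" using cAL \<open>C > 0\<close> by (auto simp: D_def intro!: divide_pos_pos add_nonneg_pos)
  \<comment> \<open>\<open>2 * D / h\<close> is the coefficient of \<open>ln m\<close> in the bound
    \<open>B\<close> below, and \<open>W\<close> is the exponential of the rest of
    \<open>B\<close>.\<close>
  define \<kappa> where "\<kappa> = nat \<lceil>2 * D / h\<rceil>"
  define W where "W = exp (2 * D / h * (1 + ln (1 + A / D)) + 1)"
  obtain G where G: "\<And>x. cmod (g x) \<le> G" using decay[of 0] by auto
  obtain E where E: "\<And>x. \<bar>x\<bar> ^ Suc \<kappa> * cmod (g x) \<le> E" using decay by blast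
  have "G \<ge> 0" using G[of 0] norm_ge_zero order_trans by blast
  have "E \<ge> 0" using E[of 0] by simp
  define U where "U = W * G * E * (2 / \<bar>a\<bar>) ^ Suc \<kappa>"
  define R where "R = \<bar>x\<^sub>0\<bar> + h"
  \<comment> \<open>The first bound gives \<open>U / m < d\<^sup>2\<close> at the end. The second
    keeps \<open>x + m * a\<close> at distance at least \<open>m * \<bar>a\<bar> / 2\<close> from
    0.\<close>
  obtain N :: nat where "max (U / d\<^sup>2) (2 * R / \<bar>a\<bar>) < real N"
    using reals_Archimedean2 by blast
  then have N: "U / d\<^sup>2 < real N" "2 * R / \<bar>a\<bar> < real N"
    by (simp_all only: max_less_iff_conj)
  obtain m :: nat and l k :: int where m: "N \<le> m" "0 < m"
    and l: "\<bar>m * a - l\<bar> < r / 2" and k: "\<bar>2 * b * l - k\<bar> \<le> C / m"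
    using return[of N] by (elim exE conjE) (rule that, simp_all only: of_nat_le_iff of_nat_0_less_iff)
  define \<eta> where "\<eta> = D / m"
  have \<eta>: "\<eta> > 0" using D m by (simp add: \<eta>_def)
  have "\<forall>i. \<exists>z. \<forall>y\<in>{x\<^sub>0 + real i * a..x\<^sub>0 + real i * a + L}. \<bar>y - z\<bar> \<le> A \<and> c * \<bar>y - z\<bar> \<le> cmod (Q y)"
    by (rule allI, rule cAL(4))
  from choice[OF this] obtain z where z: "\<forall>i. \<forall>y\<in>{x\<^sub>0 + real i * a..x\<^sub>0 + real i * a + L}.
      \<bar>y - z i\<bar> \<le> A \<and> c * \<bar>y - z i\<bar> \<le> cmod (Q y)" ..
  \<comment> \<open>\<open>f i\<close> bounds the logarithm of the growth of
    \<open>\<bar>Q\<bar>\<close> under the shift by \<open>l\<close> at the \<open>i\<close>-th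
    orbit point, as a function of the starting point.\<close>
  define f where "f i x = ln (1 + \<eta> / \<bar>x - (z i - real i * a)\<bar>)" for i :: nat and x :: real
  have near: "\<bar>x - (z i - real i * a)\<bar> \<le> A" if "x\<^sub>0 \<le> x" "x \<le> x\<^sub>0 + h" for i x
    using z[rule_format, of "x + real i * a" i] that h by (simp add: algebra_simps)
  have f_int: "f i integrable_on {x\<^sub>0..x\<^sub>0 + h}"
      "integral {x\<^sub>0..x\<^sub>0 + h} (f i) \<le> 2 * \<eta> * (1 + ln (1 + A / \<eta>))" for i
    unfolding f_def using integral_ln_singularity[OF \<eta> cAL(2) near] by auto
  \<comment> \<open>The summand 1 makes the comparison with the average strict.\<close>
  define B where "B = 2 * D / h * (1 + ln (1 + A / D) + ln m) + 1"
  \<comment> \<open>Zeros of \<open>P\<close> would prevent cancellation. At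
    \<open>z i - real i * a\<close> division by zero gives \<open>f i\<close> the value 0, which
    bounds nothing.\<close>
  define Z where "Z = (\<Union>i\<in>{1..m}. {x. P (x + real i * a) = 0} \<union> {z i - real i * a})"
  have "countable {x. P (x + t) = 0}" for t
  proof -
    have "{x. P (x + t) = 0} = (\<lambda>x. x - t) ` {x. P x = 0}"
      by (auto simp: image_iff) (metis add_diff_cancel_right')
    then show ?thesis using countable_trig_poly_zeros[OF P] by (simp add: P_def)
  qed
  then have "countable Z" by (auto simp: Z_def)
  have "integral {x\<^sub>0..x\<^sub>0 + h} (\<lambda>x. \<Sum>i=1..m. f i x) = (\<Sum>i=1..m. integral {x\<^sub>0..x\<^sub>0 + h} (f i))"
    using f_int(1) by (intro integral_sum) auto
  also have "\<dots> \<le> (\<Sum>i=1..m. 2 * \<eta> * (1 + ln (1 + A / \<eta>)))"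
    by (intro sum_mono f_int(2))
  also have "\<dots> = 2 * D * (1 + ln (1 + A * m / D))"
    using m D by (simp add: \<eta>_def)
  also have "\<dots> \<le> 2 * D * (1 + (ln (1 + A / D) + ln m))"
  proof -
    have "1 + A * m / D \<le> (1 + A / D) * m" using m by (simp add: algebra_simps)
    then have "ln (1 + A * m / D) \<le> ln ((1 + A / D) * m)"
      using m D cAL by (subst ln_le_cancel_iff) (auto intro!: add_pos_nonneg mult_pos_pos)
    also have "\<dots> = ln (1 + A / D) + ln m"
      using m D cAL by (intro ln_mult_pos) (auto intro!: add_pos_nonneg)
    finally show ?thesis using D by simp
  qed
  also have "\<dots> < B * (x\<^sub>0 + h - x\<^sub>0)"
    using h by (simp add: B_def field_simps)
  finally have average: "integral {x\<^sub>0..x\<^sub>0 + h} (\<lambda>x. \<Sum>i=1..m. f i x) < B * (x\<^sub>0 + h - x\<^sub>0)" .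
  have "(\<lambda>x. \<Sum>i=1..m. f i x) integrable_on {x\<^sub>0..x\<^sub>0 + h}"
    using f_int(1) by (intro integrable_sum) auto
  from ex_point_le_average[OF _ this average \<open>countable Z\<close>] h(1)
  obtain x where x: "x\<^sub>0 \<le> x" "x \<le> x\<^sub>0 + h" "x \<notin> Z" "(\<Sum>i=1..m. f i x) \<le> B"
    by auto
  have ratio: "cmod (Q (x + real i * a - l)) \<le> cmod (Q (x + real i * a)) * exp (f i x)"
    and Qpos: "cmod (Q (x + real i * a)) > 0" if "i \<in> {1..m}" for i
  proof -
    define s where "s = \<bar>x + real i * a - z i\<bar>"
    have "x \<noteq> z i - real i * a" using x(3) that by (auto simp: Z_def)
    then have "s > 0" by (simp add: s_def eq_diff_eq)
    have s: "c * s \<le> cmod (Q (x + real i * a))"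
      using z[rule_format, of "x + real i * a" i] x(1,2) h by (simp add: s_def)
    then show "cmod (Q (x + real i * a)) > 0" using cAL(1) \<open>s > 0\<close> by (smt (verit) mult_pos_pos)
    have "cmod (Q (x + real i * a - l)) \<le> cmod (Q (x + real i * a)) + 2 * pi * cmod q\<^sub>1 * \<bar>2 * b * l - k\<bar>"
      unfolding Q_def by (rule two_term_almost_periodic)
    also have "2 * pi * cmod q\<^sub>1 * \<bar>2 * b * l - k\<bar> \<le> 2 * pi * cmod q\<^sub>1 * (C / m)"
      using k by (intro mult_left_mono) auto
    \<comment> \<open>The lower bound \<open>c * s\<close> for \<open>\<bar>Q\<bar>\<close> turns
      the additive error \<open>c * \<eta>\<close> into the relative error
      \<open>\<eta> / s\<close>.\<close>
    also have "\<dots> \<le> c * s * (\<eta> / s)"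
      using \<open>s > 0\<close> cAL(1) m by (simp add: \<eta>_def D_def field_simps)
    also have "\<dots> \<le> cmod (Q (x + real i * a)) * (\<eta> / s)"
      using s \<eta> \<open>s > 0\<close> by (intro mult_right_mono) auto
    finally have "cmod (Q (x + real i * a - l)) \<le> cmod (Q (x + real i * a)) * (1 + \<eta> / s)"
      by (simp add: algebra_simps)
    also have "1 + \<eta> / s = exp (f i x)"
      using \<eta> \<open>s > 0\<close> by (simp add: f_def s_def add_pos_pos algebra_simps)
    finally show "cmod (Q (x + real i * a - l)) \<le> cmod (Q (x + real i * a)) * exp (f i x)" .
  qed
  let ?q = "\<Prod>i=1..m. cmod (Q (x + real i * a))"
  have "?q > 0" using Qpos by (intro prod_pos) auto
  have per: "P (y - l) = P y" for y :: real
  proof -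
    have "cis (2 * pi * (y - l)) = cis (2 * pi * y)" "cis (- (2 * pi * (y - l))) = cis (- (2 * pi * y))"
      by (simp_all add: right_diff_distrib inverse_eq_divide flip: cis_divide cis_inverse)
    then show ?thesis by (simp add: P_def)
  qed
  have nz: "P (x + real i * a) \<noteq> 0" if "i \<in> {1..m}" for i using x(3) that by (auto simp: Z_def)
  define X where "X = \<bar>x + real m * a\<bar>"
  have X: "m * \<bar>a\<bar> / 2 \<le> X" "X > 0"
  proof -
    have "2 * R / \<bar>a\<bar> < m" using N(2) m by linarith
    then have "2 * R < m * \<bar>a\<bar>" using ab by (simp add: field_simps)
    moreover have "m * \<bar>a\<bar> \<le> X + \<bar>x\<bar>"
      unfolding X_def using abs_triangle_ineq4[of "x + real m * a" x] by (simp add: abs_mult)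
    moreover have "\<bar>x\<bar> \<le> R" using x(1,2) by (simp add: R_def)
    ultimately show "m * \<bar>a\<bar> / 2 \<le> X" by simp
    then show "X > 0" using m ab by (elim order.strict_trans2[rotated]) simp
  qed
  have "d \<le> cmod (g x)" using x(1,2) h r(1) by (intro large) linarith
  moreover have "d \<le> cmod (g (x + real m * a - l))" using x(1,2) h l by (intro large) linarith
  ultimately have "d\<^sup>2 * ?q \<le> cmod (g x) * cmod (g (x + real m * a - l)) * ?q"
    unfolding power2_eq_square using d \<open>?q > 0\<close> by (intro mult_right_mono mult_mono) auto
  also have "\<dots> = cmod (g (x + real m * a)) * cmod (g (x - l)) * (\<Prod>i=1..m. cmod (Q (x + real i * a - l)))"
    using arg_cong[where f = cmod, OF transfer_exchange[where P = P and Q = Q and g = g and a = a and l = l, OF eq per nz]]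
    by (simp add: norm_mult prod_norm)
  \<comment> \<open>Of \<open>g (x - l)\<close> only boundedness is used; the smallness comes from
    \<open>g (x + real m * a)\<close>.\<close>
  also have "\<dots> \<le> cmod (g (x + real m * a)) * G * (\<Prod>i=1..m. cmod (Q (x + real i * a)) * exp (f i x))"
  proof (rule mult_mono)
    show "cmod (g (x + real m * a)) * cmod (g (x - l)) \<le> cmod (g (x + real m * a)) * G"
      by (intro mult_left_mono G) simp
    show "(\<Prod>i=1..m. cmod (Q (x + real i * a - l))) \<le> (\<Prod>i=1..m. cmod (Q (x + real i * a)) * exp (f i x))"
      by (intro prod_mono conjI ratio) simp_all
  qed (use \<open>G \<ge> 0\<close> in \<open>simp_all add: prod_nonneg\<close>)
  also have "\<dots> = (cmod (g (x + real m * a)) * G * exp (\<Sum>i=1..m. f i x)) * ?q"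
    by (simp add: prod.distrib exp_sum)
  finally have "d\<^sup>2 \<le> cmod (g (x + real m * a)) * G * exp (\<Sum>i=1..m. f i x)"
    using \<open>?q > 0\<close> by simp
  also have "\<dots> \<le> E / \<bar>x + real m * a\<bar> ^ Suc \<kappa> * G * (W * real m ^ \<kappa>)"
  proof -
    have "cmod (g (x + real m * a)) \<le> E / X ^ Suc \<kappa>"
      using E[of "x + real m * a"] X(2)
      by (subst pos_le_divide_eq) (simp_all add: X_def mult.commute)
    moreover have "exp (\<Sum>i=1..m. f i x) \<le> W * real m ^ \<kappa>"
    proof -
      have "2 * D / h * ln m \<le> \<kappa> * ln m"
        unfolding \<kappa>_def using m by (intro mult_right_mono real_nat_ceiling_ge) simp
      then have "exp B \<le> exp ((2 * D / h * (1 + ln (1 + A / D)) + 1) + \<kappa> * ln m)"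
        by (simp add: B_def algebra_simps)
      also have "\<dots> = W * real m ^ \<kappa>"
        using m by (simp only: exp_add W_def exp_of_nat_mult) simp
      finally show ?thesis using x(4) by (meson exp_le_cancel_iff order_trans)
    qed
    ultimately show ?thesis
      unfolding X_def[symmetric] using \<open>G \<ge> 0\<close> \<open>E \<ge> 0\<close> X by (intro mult_mono) auto
  qed
  also have "\<dots> \<le> E / (m * \<bar>a\<bar> / 2) ^ Suc \<kappa> * G * (W * real m ^ \<kappa>)"
    unfolding X_def[symmetric] using X m ab \<open>G \<ge> 0\<close> \<open>E \<ge> 0\<close>
    by (intro mult_right_mono divide_left_mono power_mono mult_pos_pos zero_less_power) (auto simp: W_def)
  also have "\<dots> = U / m"
    using m ab by (simp add: U_def field_simps)
  also have "\<dots> < d\<^sup>2"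
  proof -
    have "U / d\<^sup>2 < m" using N m by linarith
    then show ?thesis using d m by (simp add: field_simps)
  qed
  finally show False by simp
qed

section \<open>From almost everywhere relations to the theorem\<close>

lemma modul_eq_cis: "modul b f x = cis (2 * pi * b * x) * f x"
  by (simp add: modul_def cis_conv_exp mult_ac)

text \<open>A nonempty open set is not negligible.\<close>

lemma continuous_AE_zero_imp_zero:
  fixes F :: "real \<Rightarrow> complex"
  assumes "continuous_on UNIV F" "AE x in lborel. F x = 0"
  shows "F x = 0"
proof -
  have "AE x in lebesgue. F x = 0" using assms(2) by (rule AE_completion)
  moreover have op: "open {x. F x \<noteq> 0}"
    using assms(1) by (intro open_Collect_neq) auto
  ultimately have "{x. F x \<noteq> 0} \<in> null_sets lebesgue"
    by (subst (asm) AE_iff_null) auto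
  then have "negligible {x. F x \<noteq> 0}" by (simp add: negligible_iff_null_sets)
  then have "{x. F x \<noteq> 0} = {}" using op open_not_negligible by blast
  then show ?thesis by blast
qed

text \<open>By continuity \<open>g\<close> can be cancelled on an interval around
  \<open>x\<^sub>0\<close>; the scaling \<open>y = 2 * pi * x\<close> then leads to
  \<open>exponentials_independent\<close>.\<close>

lemma exponentials_times_nonzero:
  fixes g :: "real \<Rightarrow> complex" and c :: "real \<Rightarrow> complex"
  assumes "continuous_on UNIV g" "g x\<^sub>0 \<noteq> 0" "finite S"
    and zero: "\<And>x. (\<Sum>\<kappa>\<in>S. c \<kappa> * cis (2 * pi * \<kappa> * x)) * g x = 0"
    and "\<kappa> \<in> S"
  shows "c \<kappa> = 0"
proof -
  have "open {x. g x \<noteq> 0}"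
    using assms(1) by (intro open_Collect_neq) auto
  then obtain e where e: "e > 0" "ball x\<^sub>0 e \<subseteq> {x. g x \<noteq> 0}"
    using assms(2) unfolding open_contains_ball by blast
  have "(\<Sum>\<kappa>\<in>S. c \<kappa> * cis (\<kappa> * y)) = 0"
    if "2 * pi * (x\<^sub>0 - e) < y" "y < 2 * pi * (x\<^sub>0 + e)" for y
  proof -
    have "x\<^sub>0 - e < y / (2 * pi)" "y / (2 * pi) < x\<^sub>0 + e"
      using that by (simp_all add: field_simps)
    then have "y / (2 * pi) \<in> ball x\<^sub>0 e" by (auto simp: ball_def dist_real_def)
    then have "g (y / (2 * pi)) \<noteq> 0" using e by blast
    then show ?thesis using zero[of "y / (2 * pi)"] by simp
  qed
  then show ?thesis
    using exponentials_independent[of S "2 * pi * (x\<^sub>0 - e)" "2 * pi * (x\<^sub>0 + e)" c] assms(3,5) \<open>e > 0\<close> by simp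
qed

theorem theorem3p12:
  fixes g :: "real \<Rightarrow> complex" and a b :: real
  assumes "schwartz g"
    and "L2_norm g = 1"
    and "b \<noteq> 0"
    and "card {(0::real, 0::real), (0, 1), (0, -1), (a, b), (a, -b)} = 5"
    and "(a \<in> \<rat> \<and> b \<in> \<rat>)
         \<or> (a \<in> \<rat> \<and> b \<notin> \<rat>)
         \<or> (a \<notin> \<rat> \<and> b \<notin> \<rat> \<and> a * b \<notin> \<rat>)
         \<or> (a \<notin> \<rat> \<and> b \<notin> \<rat> \<and> a * b \<in> \<rat> \<and> (\<forall>x. Im (g x) = 0))"
  shows "lin_indep_L2 [g, M 1 g, M (-1) g, M b (T a g), M (-b) (T a g)]"
  unfolding lin_indep_L2_def
proof (rule allI, rule impI)
  let ?fs = "[g, M 1 g, M (-1) g, M b (T a g), M (-b) (T a g)]"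
  fix c :: "nat \<Rightarrow> complex"
  assume AE: "AE x in lborel. (\<Sum>i<length ?fs. c i * (?fs ! i) x) = 0"
  let ?P = "\<lambda>x. c 0 + c 1 * cis (2 * pi * x) + c 2 * cis (- (2 * pi * x))"
  let ?Q = "\<lambda>x. c 3 * cis (2 * pi * b * x) + c 4 * cis (- (2 * pi * b * x))"
  obtain D where D: "D 0 = g" "\<And>n x. (D n has_vector_derivative D (Suc n) x) (at x)"
    and D_decay: "\<And>m n. \<exists>C. \<forall>x. \<bar>x\<bar> ^ m * norm (D n x) \<le> C"
    using assms(1) unfolding schwartz_def by blast
  have decay: "\<exists>C. \<forall>x. \<bar>x\<bar> ^ m * norm (g x) \<le> C" for m
    using D_decay[of m 0] D(1) by simp
  have cont: "continuous_on UNIV g"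
    using has_vector_derivative_continuous[OF D(2)[of 0]] D(1)
    by (auto intro: continuous_at_imp_continuous_on)
  then have cont_shift: "continuous_on UNIV (\<lambda>x. g (x - a))"
    by (intro continuous_on_compose2[OF cont] continuous_intros) auto
  obtain x\<^sub>0 where x\<^sub>0: "g x\<^sub>0 \<noteq> 0"
  proof -
    have "L2_norm g = 0" if "\<forall>x. g x = 0" using that by (simp add: L2_norm_def)
    then show ?thesis using that assms(2) by fastforce
  qed
  have "{..<length ?fs} = {0, 1, 2, 3, 4}" by auto
  then have "(\<Sum>i<length ?fs. c i * (?fs ! i) x) = ?P x * g x + ?Q x * g (x - a)" for x
    by (simp only:) (simp add: modul_eq_cis transl_def algebra_simps)
  with AE have "AE x in lborel. ?P x * g x + ?Q x * g (x - a) = 0" by (simp only:)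
  moreover have "continuous_on UNIV (\<lambda>x. ?P x * g x + ?Q x * g (x - a))"
    by (intro continuous_intros cont cont_shift)
  ultimately have eq: "?P x * g x + ?Q x * g (x - a) = 0" for x
    by (rule continuous_AE_zero_imp_zero[rotated])
  \<comment> \<open>\<open>P0\<close> and \<open>Q0\<close> finish the proof once one of the two
    groups of coefficients is known to vanish.\<close>
  have P0: "c 0 = 0 \<and> c 1 = 0 \<and> c 2 = 0" if P: "\<And>x. ?P x * g x = 0"
  proof -
    define C where "C \<kappa> = (if \<kappa> = 0 then c 0 else if \<kappa> = 1 then c 1 else c 2)" for \<kappa> :: real
    have "(\<Sum>\<kappa>\<in>{0, 1, -1}. C \<kappa> * cis (2 * pi * \<kappa> * x)) * g x = 0" for x
      using P[of x] by (simp add: C_def add.assoc)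
    then have "C \<kappa> = 0" if "\<kappa> \<in> {0, 1, -1}" for \<kappa>
      by (rule exponentials_times_nonzero[OF cont x\<^sub>0 _ _ that, rotated]) simp
    from this[of 0] this[of 1] this[of "-1"] show ?thesis by (simp add: C_def)
  qed
  have Q0: "c 3 = 0 \<and> c 4 = 0" if Q: "\<And>x. ?Q x * g (x - a) = 0"
  proof -
    define C where "C \<kappa> = (if \<kappa> = b then c 3 else c 4)" for \<kappa> :: real
    have "(\<Sum>\<kappa>\<in>{b, -b}. C \<kappa> * cis (2 * pi * \<kappa> * x)) * g (x - a) = 0" for x
      using assms(3) Q[of x] by (simp add: C_def)
    moreover have "g (x\<^sub>0 + a - a) \<noteq> 0" using x\<^sub>0 by simp
    ultimately have "C \<kappa> = 0" if "\<kappa> \<in> {b, -b}" for \<kappa>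
      by (rule exponentials_times_nonzero[OF cont_shift _ _ _ that, rotated 2]) simp
    from this[of b] this[of "-b"] show ?thesis using assms(3) by (simp add: C_def)
  qed
  have "c 0 = 0 \<and> c 1 = 0 \<and> c 2 = 0 \<and> c 3 = 0 \<and> c 4 = 0"
  proof (cases "a = 0")
    case True
    \<comment> \<open>Without translation all five functions are exponentials times
      \<open>g\<close>, and the cardinality assumption makes their frequencies distinct.\<close>
    have "b \<noteq> 1" "b \<noteq> -1" using assms(4) True by (auto simp: card_insert_if split: if_splits)
    then have ne: "b \<noteq> 0" "b \<noteq> 1" "1 \<noteq> b" "b \<noteq> -1" "-1 \<noteq> b" "-b \<noteq> 1" "1 \<noteq> -b" "b \<noteq> -b" "-b \<noteq> b"
      using assms(3) by linarith+
    define C where "C \<kappa> = (if \<kappa> = 0 then c 0 else if \<kappa> = 1 then c 1 else if \<kappa> = -1 then c 2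
      else if \<kappa> = b then c 3 else c 4)" for \<kappa> :: real
    have C: "C 0 = c 0" "C 1 = c 1" "C (-1) = c 2" "C b = c 3" "C (-b) = c 4"
      unfolding C_def using ne by simp_all
    have "(\<Sum>\<kappa>\<in>{0, 1, -1, b, -b}. C \<kappa> * cis (2 * pi * \<kappa> * x)) * g x = (?P x + ?Q x) * g x" for x
      using ne by (simp add: C add.assoc)
    also have "(?P x + ?Q x) * g x = 0" for x
      using eq[of x] True by (simp only: diff_zero distrib_right)
    finally have "C \<kappa> = 0" if "\<kappa> \<in> {0, 1, -1, b, -b}" for \<kappa>
      by (rule exponentials_times_nonzero[OF cont x\<^sub>0 _ _ that, rotated]) simp
    from this[of 0] this[of 1] this[of "-1"] this[of b] this[of "-b"] show ?thesis using C by simp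
  next
    case False
    have eq': "?P x * g x = ((- c 3) * cis (2 * pi * b * x) + (- c 4) * cis (- (2 * pi * b * x))) * g (x - a)" for x
      using eq[of x] unfolding add_eq_0_iff2 by (simp add: algebra_simps)
    have "(c 0 = 0 \<and> c 1 = 0 \<and> c 2 = 0) \<or> (c 3 = 0 \<and> c 4 = 0)"
      using no_decaying_solution[OF False assms(3) cont decay eq'] x\<^sub>0 by auto
    then show ?thesis
    proof
      assume "c 0 = 0 \<and> c 1 = 0 \<and> c 2 = 0"
      then show ?thesis using Q0 eq by simp
    next
      assume "c 3 = 0 \<and> c 4 = 0"
      then show ?thesis using P0 eq by simp
    qed
  qed
  moreover have "i \<in> {0, 1, 2, 3, 4}" if "i < length ?fs" for i using that by auto
  ultimately show "\<forall>i<length ?fs. c i = 0" by blast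
qed

end
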